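(* Let $D$ be a non-zero $n\times n$ generalized Euclidean distance matrix. Then $D$ is similar to a (real) symmetric matrix, and $D$ has exactly one positive eigenvalue.
   Context: All matrices are real. $\mathbf{1}\in\mathbb{R}^n$ is the vector of all ones. An $n\times n$ real symmetric matrix $L$ is a generalized Laplacian matrix if $L$ is positive semidefinite and $L\mathbf{1}=0$. An $n\times n$ matrix $D=[d_{ij}]$ is a generalized Euclidean distance matrix if there exist real numbers $a,b>0$ and an $n\times n$ generalized Laplacian matrix $L=[l_{ij}]$ such that $d_{ij}=a^2 l_{ii}+b^2 l_{jj}-2ab\,l_{ij}$ for all $i,j$. Eigenvalues are counted with multiplicity. *)

theory Defs
  imports Complex_Main "Jordan_Normal_Form.Char_Poly"
begin

definition symmetric_matrix :: "real mat \<Rightarrow> bool" where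
  "symmetric_matrix A \<longleftrightarrow> square_mat A \<and> transpose_mat A = A"

definition pos_semidef :: "real mat \<Rightarrow> bool" where
  "pos_semidef A \<longleftrightarrow> symmetric_matrix A \<and>
     (\<forall>x \<in> carrier_vec (dim_row A). x \<bullet> (A *\<^sub>v x) \<ge> 0)"

definition ones_vec :: "nat \<Rightarrow> real vec" where
  "ones_vec n = vec n (\<lambda>_. 1)"

definition gen_laplacian :: "nat \<Rightarrow> real mat \<Rightarrow> bool" where
  "gen_laplacian n L \<longleftrightarrow> L \<in> carrier_mat n n \<and> pos_semidef L \<and>
     L *\<^sub>v ones_vec n = 0\<^sub>v n"

definition gen_euclidean_dist :: "nat \<Rightarrow> real mat \<Rightarrow> bool" where
  "gen_euclidean_dist n D \<longleftrightarrow> D \<in> carrier_mat n n \<and>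
     (\<exists>a b L. a > 0 \<and> b > 0 \<and> gen_laplacian n L \<and>
       (\<forall>i<n. \<forall>j<n. D $$ (i,j) =
          a\<^sup>2 * L $$ (i,i) + b\<^sup>2 * L $$ (j,j) - 2 * a * b * L $$ (i,j)))"

(* The number of positive real eigenvalues, counted with algebraic multiplicity.
   The index set is finite for a square matrix, since its characteristic polynomial is monic.
   Polynomial.order is qualified because HOL-Algebra has an order of its own. *)
definition num_pos_eigenvalues :: "real mat \<Rightarrow> nat" where
  "num_pos_eigenvalues A =
     (\<Sum>x \<in> {x. eigenvalue A x \<and> x > 0}. Polynomial.order x (char_poly A))"

end

theory Submission
  imports Defs "Jordan_Normal_Form.Schur_Decomposition"
begin

text \<open>Let \<open>m\<close> be the mean of the diagonal of \<open>L\<close>. In an orthogonal splitting into the line of the all-ones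
  vector and its complement, the two off-diagonal blocks of \<open>D\<close> are proportional, up to
  transposition, with ratio \<open>(a/b)\<^sup>2\<close>. Rescaling the all-ones direction by \<open>b/a\<close> balances them and
  turns \<open>D\<close> into the symmetric matrix \<open>S\<close> with entries
  \<open>a b (L\<^sub>i\<^sub>i + L\<^sub>j\<^sub>j - 2 L\<^sub>i\<^sub>j) + m (a - b)\<^sup>2\<close>.

  On the vectors orthogonal to the all-ones vector, the form of \<open>S\<close> is \<open>-2 a b\<close> times that of \<open>L\<close>,
  hence at most one eigenvalue of \<open>S\<close> is positive. If none were, the nonnegative trace
  \<open>n m (a - b)\<^sup>2\<close> would force all eigenvalues to vanish, and a symmetric matrix with only zero
  eigenvalues is zero. The spectral theorem is not needed: a triangularisation over the reals with
  the positive eigenvalues listed first is enough.\<close>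

section \<open>Real symmetric matrices and their real spectrum\<close>

lemma symmetric_matrixD:
  assumes "symmetric_matrix S" "S \<in> carrier_mat n n" "i < n" "j < n"
  shows "S $$ (i,j) = S $$ (j,i)"
  using assms unfolding symmetric_matrix_def
  by (metis carrier_matD index_transpose_mat(1))

lemma symmetric_scalar_prod:
  fixes S :: "'a :: comm_semiring_0 mat"
  assumes "S \<in> carrier_mat n n" "transpose_mat S = S" "x \<in> carrier_vec n" "y \<in> carrier_vec n"
  shows "(S *\<^sub>v x) \<bullet> y = x \<bullet> (S *\<^sub>v y)"
  using transpose_vec_mult_scalar[OF assms(1,4,3)] assms by simp

lemma mult_mat_unit_vec:
  fixes A :: "'a :: semiring_1 mat"
  assumes "A \<in> carrier_mat m n" "i < n"
  shows "A *\<^sub>v unit_vec n i = col A i"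
  using assms by (intro eq_vecI) auto

lemma scalar_prod_self_pos:
  fixes x :: "real vec"
  assumes "x \<in> carrier_vec n" "x \<noteq> 0\<^sub>v n"
  shows "x \<bullet> x > 0"
proof -
  have "conjugate x = x" by (intro eq_vecI) auto
  thus ?thesis using conjugate_square_greater_0_vec[OF assms(1)] assms(2) by simp
qed

text \<open>As the entries are real, conjugating an eigenvector \<open>v\<close> for
  \<open>e\<close> gives one for \<open>cnj e\<close>. Moving the symmetric matrix from one side of
  \<open>v \<bullet>c v\<close> to the other then forces \<open>e = cnj e\<close>.\<close>

lemma symmetric_eigenvalue_real:
  assumes S: "S \<in> carrier_mat n n" and sym: "symmetric_matrix S"
    and ev: "eigenvalue (map_mat complex_of_real S) e"
  shows "e \<in> \<real>"
proof -
  let ?M = "map_mat complex_of_real S"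
  have M: "?M \<in> carrier_mat n n" using S by simp
  have tM: "transpose_mat ?M = ?M"
    using sym unfolding symmetric_matrix_def by (simp add: map_mat_transpose)
  obtain v where v: "v \<in> carrier_vec n" "v \<noteq> 0\<^sub>v n" "?M *\<^sub>v v = e \<cdot>\<^sub>v v"
    using ev M unfolding eigenvalue_def eigenvector_def by auto
  have cv: "conjugate v \<in> carrier_vec n" using v by simp
  have "?M *\<^sub>v conjugate v = conjugate (?M *\<^sub>v v)"
    by (intro eq_vecI) (use S v(1) in \<open>auto simp: scalar_prod_def\<close>)
  also have "\<dots> = cnj e \<cdot>\<^sub>v conjugate v" by (simp add: v(3) conjugate_smult_vec)
  finally have cM: "?M *\<^sub>v conjugate v = cnj e \<cdot>\<^sub>v conjugate v" .
  have "e * (v \<bullet>c v) = (?M *\<^sub>v v) \<bullet>c v" using v cv by simp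
  also have "\<dots> = v \<bullet> (?M *\<^sub>v conjugate v)" by (rule symmetric_scalar_prod[OF M tM v(1) cv])
  also have "\<dots> = cnj e * (v \<bullet>c v)" using v cv by (simp add: cM)
  finally have "e = cnj e" using conjugate_square_eq_0_vec[OF v(1)] v(2) by simp
  thus ?thesis using Reals_cnj_iff by metis
qed

text \<open>The complex factorization has only real roots, and it descends because the embedding of
  real polynomials is injective. The resulting factor list is what
  \<open>schur_decomposition\<close> needs over the reals.\<close>

lemma char_poly_symmetric_splits:
  assumes S: "S \<in> carrier_mat n n" and sym: "symmetric_matrix S"
  shows "\<exists>es. char_poly S = (\<Prod>e\<leftarrow>es. [:- e, 1:])"
proof -
  let ?M = "map_mat complex_of_real S"
  interpret h: map_poly_inj_comm_ring_hom complex_of_real ..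
  have M: "?M \<in> carrier_mat n n" using S by simp
  obtain as where as: "char_poly ?M = (\<Prod>a\<leftarrow>as. [:- a, 1:])"
    using char_poly_factorized[OF M] by blast
  have "a \<in> \<real>" if "a \<in> set as" for a
  proof (rule symmetric_eigenvalue_real[OF S sym])
    show "eigenvalue ?M a"
      unfolding eigenvalue_root_char_poly[OF M] as poly_prod_list using that by (auto simp: prod_list_zero_iff)
  qed
  hence "as = map complex_of_real (map Re as)" by (auto simp: o_def intro!: map_idI[symmetric])
  then obtain es where es: "as = map complex_of_real es" by blast
  have "map_poly complex_of_real (char_poly S) = char_poly ?M"
    by (rule of_real_hom.char_poly_hom[OF S, symmetric])
  also have "\<dots> = map_poly complex_of_real (\<Prod>e\<leftarrow>es. [:- e, 1:])"
    unfolding as es by (simp add: h.hom_prod_list o_def)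
  finally show ?thesis by (auto intro!: exI[of _ es])
qed

section \<open>Traces and triangular forms of symmetric matrices\<close>

lemma trace_mult_comm:
  fixes A :: "'a :: comm_semiring_0 mat"
  assumes "A \<in> carrier_mat n m" "B \<in> carrier_mat m n"
  shows "(\<Sum>i<n. (A * B) $$ (i,i)) = (\<Sum>i<m. (B * A) $$ (i,i))"
proof -
  have "(\<Sum>i<n. (A * B) $$ (i,i)) = (\<Sum>i<n. \<Sum>k<m. A $$ (i,k) * B $$ (k,i))"
    using assms by (intro sum.cong) (auto simp: scalar_prod_def atLeast0LessThan)
  also have "\<dots> = (\<Sum>k<m. \<Sum>i<n. B $$ (k,i) * A $$ (i,k))"
    by (subst sum.swap) (simp add: mult.commute)
  also have "\<dots> = (\<Sum>i<m. (B * A) $$ (i,i))"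
    using assms by (intro sum.cong) (auto simp: scalar_prod_def atLeast0LessThan)
  finally show ?thesis .
qed

lemma trace_similar:
  fixes A :: "'a :: comm_ring_1 mat"
  assumes "A \<in> carrier_mat n n" "similar_mat_wit A B P Q"
  shows "(\<Sum>i<n. A $$ (i,i)) = (\<Sum>i<n. B $$ (i,i))"
proof -
  note w = similar_mat_witD2[OF assms]
  have "(\<Sum>i<n. A $$ (i,i)) = (\<Sum>i<n. (P * (B * Q)) $$ (i,i))"
    using w by (simp add: assoc_mult_mat[of _ n n _ n _ n])
  also have "\<dots> = (\<Sum>i<n. (B * Q * P) $$ (i,i))"
    using w by (intro trace_mult_comm) auto
  also have "B * Q * P = B" using w by (simp add: assoc_mult_mat[of _ n n _ n _ n])
  finally show ?thesis .
qed

text \<open>The reason is \<open>tr (S\<^sup>2) = tr (B\<^sup>2) = 0\<close>, where the left side is the sum of the squared entries of \<open>S\<close>.\<close>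

lemma symmetric_nilpotent_eq_0:
  assumes S: "S \<in> carrier_mat n n" and sym: "symmetric_matrix S"
    and wit: "similar_mat_wit S B P Q" and tri: "upper_triangular B"
    and diag: "\<And>i. i < n \<Longrightarrow> B $$ (i,i) = 0"
  shows "S = 0\<^sub>m n n"
proof -
  note w = similar_mat_witD2[OF S wit]
  have BB: "(B * B) $$ (i,i) = 0" if "i < n" for i
  proof -
    \<comment> \<open>For \<open>k \<noteq> i\<close> one of the two factors lies below the
      diagonal; for \<open>k = i\<close> both are diagonal entries.\<close>
    have "B $$ (i,k) * B $$ (k,i) = 0" if "k < n" for k
      using tri diag[OF \<open>i < n\<close>] w \<open>i < n\<close> that by (cases k i rule: linorder_cases) (auto dest: upper_triangularD)
    thus ?thesis using w that by (auto simp: scalar_prod_def intro!: sum.neutral)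
  qed
  have "S * S = P * (B * B) * Q"
    using similar_mat_wit_pow_id[OF wit, of 2] w by (simp add: numeral_2_eq_2)
  hence "similar_mat_wit (S * S) (B * B) P Q"
    using w by (intro similar_mat_witI[of _ _ n]) auto
  hence "(\<Sum>i<n. (S * S) $$ (i,i)) = 0"
    using trace_similar[of "S * S" n] S BB by simp
  moreover have "(S * S) $$ (i,i) = (\<Sum>k<n. (S $$ (i,k))\<^sup>2)" if "i < n" for i
    using S that symmetric_matrixD[OF sym S that]
    by (simp add: scalar_prod_def atLeast0LessThan power2_eq_square)
  ultimately have "(\<Sum>i<n. \<Sum>k<n. (S $$ (i,k))\<^sup>2) = 0" by simp
  hence "S $$ (i,k) = 0" if "i < n" "k < n" for i k
    using that by (simp add: sum_nonneg_eq_0_iff sum_nonneg)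
  thus ?thesis using S by (intro eq_matI) auto
qed

text \<open>The first two columns of \<open>P\<close> span an invariant plane. Symmetry of \<open>S\<close> makes it the span of
  two orthogonal eigenvectors, so \<open>S\<close> is positive definite on a plane, which meets \<open>w\<^sup>\<bottom>\<close>.\<close>

lemma not_two_positive:
  assumes S: "S \<in> carrier_mat n n" and sym: "symmetric_matrix S"
    and wit: "similar_mat_wit S B P Q" and tri: "upper_triangular B" and n: "1 < n"
    and pos: "B $$ (0,0) > 0" "B $$ (1,1) > 0"
    and w: "w \<in> carrier_vec n"
    and nsd: "\<And>x. x \<in> carrier_vec n \<Longrightarrow> w \<bullet> x = 0 \<Longrightarrow> x \<bullet> (S *\<^sub>v x) \<le> 0"
  shows False
proof -
  note W = similar_mat_witD2[OF S wit]
  have tS: "transpose_mat S = S" using sym by (simp add: symmetric_matrix_def)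
  let ?l = "B $$ (0,0)" and ?m = "B $$ (1,1)"
  define p where "p = col P 0"
  define q where "q = col P 1"
  have p: "p \<in> carrier_vec n" and q: "q \<in> carrier_vec n" unfolding p_def q_def using W by auto
  have SP: "S * P = P * B"
    using W by (simp add: assoc_mult_mat[of _ n n _ n _ n])
  have Scol: "S *\<^sub>v col P j = P *\<^sub>v col B j" if "j < n" for j
    using col_mult2[OF S W(6) that] col_mult2[OF W(6,5) that] SP by metis
  have Sp: "S *\<^sub>v p = ?l \<cdot>\<^sub>v p"
  proof -
    have "col B 0 = ?l \<cdot>\<^sub>v unit_vec n 0"
      using W tri n by (intro eq_vecI) (auto simp: unit_vec_def)
    moreover have "P *\<^sub>v unit_vec n 0 = p" unfolding p_def using W n by (simp add: mult_mat_unit_vec)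
    ultimately show ?thesis using Scol[of 0] W n unfolding p_def
      by (simp add: mult_mat_vec)
  qed
  have Sq: "S *\<^sub>v q = B $$ (0,1) \<cdot>\<^sub>v p + ?m \<cdot>\<^sub>v q"
  proof -
    have "col B 1 = B $$ (0,1) \<cdot>\<^sub>v unit_vec n 0 + ?m \<cdot>\<^sub>v unit_vec n 1"
      using W tri n by (intro eq_vecI) (auto simp: unit_vec_def)
    moreover have "P *\<^sub>v unit_vec n 0 = p" "P *\<^sub>v unit_vec n 1 = q"
      unfolding p_def q_def using W n by (simp_all add: mult_mat_unit_vec)
    ultimately show ?thesis using Scol[of 1] W n unfolding q_def
      by (simp add: mult_mat_vec mult_add_distrib_mat_vec[of _ n n])
  qed
  \<comment> \<open>\<open>Q\<close> inverts \<open>P\<close>, so it carries \<open>p\<close> and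
    \<open>q\<close> to unit vectors; this shows that \<open>p\<close>, and later \<open>r\<close>,
    are nonzero.\<close>
  have Qp: "Q *\<^sub>v p = unit_vec n 0" and Qq: "Q *\<^sub>v q = unit_vec n 1"
    unfolding p_def q_def using W n
    by (simp_all add: col_mult2[of _ n n _ n, symmetric])
  have Q0: "Q *\<^sub>v 0\<^sub>v n = 0\<^sub>v n" using W by (intro eq_vecI) auto
  have "unit_vec n 0 \<noteq> (0\<^sub>v n :: real vec)" using n by simp
  hence "p \<noteq> 0\<^sub>v n" using Qp Q0 by metis
  hence pp: "p \<bullet> p > 0" using scalar_prod_self_pos[OF p] by simp
  \<comment> \<open>Gram-Schmidt: \<open>r\<close> is the component of \<open>q\<close> orthogonal
    to \<open>p\<close>.\<close>
  define c where "c = (p \<bullet> q) / (p \<bullet> p)"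
  define r where "r = q + (- c) \<cdot>\<^sub>v p"
  have r: "r \<in> carrier_vec n" unfolding r_def using p q by simp
  have "Q *\<^sub>v r = unit_vec n 1 + (- c) \<cdot>\<^sub>v unit_vec n 0"
    unfolding r_def using W p q by (simp add: mult_add_distrib_mat_vec[of _ n n] mult_mat_vec Qp Qq)
  hence "(Q *\<^sub>v r) $ 1 = 1" using n by simp
  hence "r \<noteq> 0\<^sub>v n" using Q0 n by auto
  hence rr: "r \<bullet> r > 0" using scalar_prod_self_pos[OF r] by simp
  have pr: "p \<bullet> r = 0"
    unfolding r_def using p q pp
    by (simp add: scalar_prod_add_distrib[of _ n] c_def)
  have rp: "r \<bullet> p = 0" using pr comm_scalar_prod[OF p r] by simp
  \<comment> \<open>The coefficient of \<open>p\<close> in \<open>S *\<^sub>v r\<close>. It vanishes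
    because \<open>S *\<^sub>v p\<close> is a multiple of \<open>p\<close>, hence orthogonal to
    \<open>r\<close>, so \<open>r\<close> is an eigenvector too.\<close>
  define d where "d = B $$ (0,1) + ?m * c - c * ?l"
  have Sr: "S *\<^sub>v r = d \<cdot>\<^sub>v p + ?m \<cdot>\<^sub>v r"
  proof -
    have "S *\<^sub>v r = (B $$ (0,1) \<cdot>\<^sub>v p + ?m \<cdot>\<^sub>v q) + (- c) \<cdot>\<^sub>v (?l \<cdot>\<^sub>v p)"
      unfolding r_def using S p q by (simp add: mult_add_distrib_mat_vec[of _ n n] mult_mat_vec Sp Sq)
    also have "\<dots> = d \<cdot>\<^sub>v p + ?m \<cdot>\<^sub>v r"
      unfolding r_def d_def using p q by (intro eq_vecI) (auto simp: algebra_simps)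
    finally show ?thesis .
  qed
  have "d * (p \<bullet> p) = p \<bullet> (S *\<^sub>v r)"
    unfolding Sr using p r by (simp add: scalar_prod_add_distrib[of _ n] pr)
  also have "\<dots> = (S *\<^sub>v p) \<bullet> r" by (rule symmetric_scalar_prod[OF S tS p r, symmetric])
  also have "\<dots> = 0" unfolding Sp using p r by (simp add: pr)
  finally have "d = 0" using pp by simp
  hence Sr: "S *\<^sub>v r = ?m \<cdot>\<^sub>v r" unfolding Sr using p r by (intro eq_vecI) auto
  \<comment> \<open>These solve \<open>w \<bullet> x = 0\<close> in the plane of \<open>p\<close>
    and \<open>r\<close>. The case split keeps \<open>x\<close> nonzero: if
    \<open>w \<bullet> p = 0\<close>, then \<open>p\<close> itself serves; otherwise
    \<open>\<beta>\<close> is nonzero.\<close>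
  define \<alpha> where "\<alpha> = (if w \<bullet> p = 0 then 1 else - (w \<bullet> r))"
  define \<beta> where "\<beta> = (if w \<bullet> p = 0 then 0 else w \<bullet> p)"
  define x where "x = \<alpha> \<cdot>\<^sub>v p + \<beta> \<cdot>\<^sub>v r"
  have x: "x \<in> carrier_vec n" unfolding x_def using p r by simp
  have "w \<bullet> x = 0"
    unfolding x_def using p r w by (simp add: scalar_prod_add_distrib[of _ n] \<alpha>_def \<beta>_def)
  hence le: "x \<bullet> (S *\<^sub>v x) \<le> 0" by (rule nsd[OF x])
  have "S *\<^sub>v x = (\<alpha> * ?l) \<cdot>\<^sub>v p + (\<beta> * ?m) \<cdot>\<^sub>v r"
    unfolding x_def using S p r
    by (simp add: mult_add_distrib_mat_vec[of _ n n] mult_mat_vec Sp Sr smult_smult_assoc)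
  hence "x \<bullet> (S *\<^sub>v x) = \<alpha>\<^sup>2 * ?l * (p \<bullet> p) + \<beta>\<^sup>2 * ?m * (r \<bullet> r)"
    unfolding x_def using p r
    by (simp add: scalar_prod_add_distrib[of _ n] add_scalar_prod_distrib[of _ n] pr rp power2_eq_square)
  moreover have "\<alpha> \<noteq> 0 \<or> \<beta> \<noteq> 0" by (simp add: \<alpha>_def \<beta>_def)
  hence "\<alpha>\<^sup>2 * ?l * (p \<bullet> p) + \<beta>\<^sup>2 * ?m * (r \<bullet> r) > 0"
  proof
    assume "\<alpha> \<noteq> 0"
    thus ?thesis using pos pp rr by (intro add_pos_nonneg) simp_all
  next
    assume "\<beta> \<noteq> 0"
    thus ?thesis using pos pp rr by (intro add_nonneg_pos) simp_all
  qed
  ultimately show False using le by simp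
qed

section \<open>Counting the positive eigenvalues\<close>

lemma num_pos_eigenvalues_eq_1:
  assumes S: "S \<in> carrier_mat n n" and sym: "symmetric_matrix S"
    and w: "w \<in> carrier_vec n"
    and nsd: "\<And>x. x \<in> carrier_vec n \<Longrightarrow> w \<bullet> x = 0 \<Longrightarrow> x \<bullet> (S *\<^sub>v x) \<le> 0"
    and tr: "(\<Sum>i<n. S $$ (i,i)) \<ge> 0" and S0: "S \<noteq> 0\<^sub>m n n"
  shows "num_pos_eigenvalues S = 1"
proof -
  obtain es where es: "char_poly S = (\<Prod>e\<leftarrow>es. [:- e, 1:])"
    using char_poly_symmetric_splits[OF S sym] by blast
  \<comment> \<open>The order matters: the decomposition keeps the order of the list on the diagonal
    of \<open>B\<close>, so two positive roots would sit at positions 0 and 1, as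
    \<open>not_two_positive\<close> expects.\<close>
  define ps where "ps = filter (\<lambda>e. e > 0) es"
  define ns where "ns = filter (\<lambda>e. \<not> e > 0) es"
  have "mset (ps @ ns) = mset es" unfolding ps_def ns_def by simp
  hence "mset (map (\<lambda>e. [:- e, 1:]) (ps @ ns)) = mset (map (\<lambda>e. [:- e, 1:]) es)"
    by (metis mset_map)
  hence cp: "char_poly S = (\<Prod>e\<leftarrow>ps @ ns. [:- e, 1:])"
    unfolding es by (metis prod_mset_prod_list)
  obtain B P Q where "schur_decomposition S (ps @ ns) = (B,P,Q)" by (cases "schur_decomposition S (ps @ ns)")
  from schur_decomposition[OF S cp this]
  have wit: "similar_mat_wit S B P Q" and tri: "upper_triangular B" and diag: "diag_mat B = ps @ ns"
    by auto
  have B: "B \<in> carrier_mat n n" using similar_mat_witD2[OF S wit] by simp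
  have len: "length (ps @ ns) = n" unfolding diag[symmetric] using B by (simp add: diag_mat_def)
  have Bi: "B $$ (i,i) = (ps @ ns) ! i" if "i < n" for i
    unfolding diag[symmetric] using B that by (simp add: diag_mat_def)
  have "ps \<noteq> []"
  proof
    assume "ps = []"
    hence le: "B $$ (i,i) \<le> 0" if "i < n" for i
      using that len Bi[OF that] nth_mem[of i ns] by (auto simp: ns_def)
    have "(\<Sum>i<n. - B $$ (i,i)) \<le> 0"
      using tr trace_similar[OF S wit] by (simp add: sum_negf)
    hence "(\<Sum>i<n. - B $$ (i,i)) = 0"
      using le by (intro antisym sum_nonneg) auto
    hence "B $$ (i,i) = 0" if "i < n" for i
      using le that by (subst (asm) sum_nonneg_eq_0_iff) auto
    from symmetric_nilpotent_eq_0[OF S sym wit tri this] S0 show False by simp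
  qed
  moreover have "False" if ps: "ps = l # m # rs" for l m rs
  proof -
    have n: "1 < n" using len ps by auto
    have "l \<in> set ps" "m \<in> set ps" by (simp_all add: ps)
    hence "l > 0" "m > 0" unfolding ps_def by auto
    hence "B $$ (0,0) > 0" "B $$ (1,1) > 0" using Bi[of 0] Bi[of 1] n ps by auto
    thus False by (rule not_two_positive[OF S sym wit tri n _ _ w nsd])
  qed
  ultimately obtain l where ps: "ps = [l]" by (metis list.exhaust)
  hence "l \<in> set ps" by simp
  hence l: "l > 0" unfolding ps_def by simp
  define q where "q = (\<Prod>e\<leftarrow>ns. [:- e, 1:])"
  have cq: "char_poly S = [:- l, 1:] * q" by (simp add: cp ps q_def)
  have root: "poly q x = 0 \<longleftrightarrow> x \<in> set ns" for x
    unfolding q_def poly_prod_list by (auto simp: prod_list_zero_iff)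
  have "{x. eigenvalue S x \<and> x > 0} = {l}"
    unfolding eigenvalue_root_char_poly[OF S] cq using l root by (auto simp: ns_def)
  \<comment> \<open>No member of \<open>ns\<close> is positive, so \<open>l\<close> is a simple
    root.\<close>
  moreover have "poly q l \<noteq> 0" unfolding root using l by (simp add: ns_def)
  hence "Polynomial.order l q = 0" "q \<noteq> 0" by (auto simp: order_root)
  hence "Polynomial.order l (char_poly S) = 1"
    unfolding cq using no_zero_divisors[of "[:- l, 1:]" q] by (subst order_mult) (simp_all add: order_linear')
  ultimately show ?thesis by (simp add: num_pos_eigenvalues_def)
qed

section \<open>Similarity and the scaling along the all-ones vector\<close>

lemma num_pos_eigenvalues_similar:
  assumes "A \<in> carrier_mat n n" "similar_mat A B"
  shows "num_pos_eigenvalues A = num_pos_eigenvalues B"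
proof -
  have B: "B \<in> carrier_mat n n" using assms similar_matD[OF assms(2)] by auto
  show ?thesis
    unfolding num_pos_eigenvalues_def eigenvalue_root_char_poly[OF assms(1)]
      eigenvalue_root_char_poly[OF B] char_poly_similar[OF assms(2)] ..
qed

text \<open>\<open>I + (c/n) J\<close> scales the all-ones direction by \<open>1 + c\<close> and fixes its orthogonal complement.\<close>

definition ones_scaling :: "nat \<Rightarrow> real \<Rightarrow> real mat" where
  "ones_scaling n c = mat n n (\<lambda>(i,j). (if i = j then 1 else 0) + c / real n)"

lemma ones_scaling_carrier [simp]: "ones_scaling n c \<in> carrier_mat n n"
  by (simp add: ones_scaling_def)

text \<open>The constant summand of \<open>ones_scaling\<close> contributes a multiple of a column
  or row sum, so the similarity in the theorem reduces to computing such sums.\<close>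

lemma ones_scaling_mult_index:
  assumes "A \<in> carrier_mat n n" "i < n" "j < n"
  shows "(ones_scaling n c * A) $$ (i,j) = A $$ (i,j) + c / n * (\<Sum>k<n. A $$ (k,j))"
    and "(A * ones_scaling n c) $$ (i,j) = A $$ (i,j) + c / n * (\<Sum>k<n. A $$ (i,k))"
  using assms
  by (simp_all add: ones_scaling_def scalar_prod_def atLeast0LessThan distrib_left distrib_right
      sum.distrib sum_distrib_left if_distrib[of "\<lambda>x. x * _"] if_distrib[of "\<lambda>x. _ * x"]
      sum.delta mult.commute cong: if_cong)

text \<open>The hypothesis amounts to \<open>(1 + c) * (1 + d) = 1\<close>, so the two scalings of
  the all-ones direction cancel.\<close>

lemma ones_scaling_mult:
  assumes "c + d + c * d = 0"
  shows "ones_scaling n c * ones_scaling n d = 1\<^sub>m n"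
proof (intro eq_matI)
  fix i j assume ij: "i < dim_row (1\<^sub>m n)" "j < dim_col (1\<^sub>m n)"
  hence n: "real n > 0" by simp
  have "(\<Sum>k<n. ones_scaling n d $$ (k,j)) = 1 + d"
    using ij n by (simp add: ones_scaling_def sum.distrib)
  hence "(ones_scaling n c * ones_scaling n d) $$ (i,j)
      = (if i = j then 1 else 0) + (d + c * (1 + d)) / n"
    using ij by (simp add: ones_scaling_mult_index(1) del: index_mult_mat)
      (simp add: ones_scaling_def add_divide_distrib)
  also have "d + c * (1 + d) = 0" using assms by (simp add: algebra_simps)
  finally show "(ones_scaling n c * ones_scaling n d) $$ (i,j) = 1\<^sub>m n $$ (i,j)" using ij by simp
qed (simp_all add: ones_scaling_def)

section \<open>Generalized Laplacians and their distance matrices\<close>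

lemma pos_semidef_diag_nonneg:
  assumes "pos_semidef L" "L \<in> carrier_mat n n" "i < n"
  shows "L $$ (i,i) \<ge> 0"
proof -
  have "unit_vec n i \<bullet> (L *\<^sub>v unit_vec n i) = L $$ (i,i)"
    using assms by (simp add: mult_mat_unit_vec)
  moreover have "unit_vec n i \<bullet> (L *\<^sub>v unit_vec n i) \<ge> 0"
    using assms(1,2) unfolding pos_semidef_def by (metis carrier_matD(1) unit_vec_carrier)
  ultimately show ?thesis by simp
qed

theorem theorem2p1:
  fixes n :: nat and D :: "real mat"
  assumes "gen_euclidean_dist n D"
    and "D \<noteq> 0\<^sub>m n n"
  shows "(\<exists>S \<in> carrier_mat n n. symmetric_matrix S \<and> similar_mat D S) \<and>
         num_pos_eigenvalues D = 1"
proof -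
  obtain a b L where D: "D \<in> carrier_mat n n" and ab: "a > 0" "b > 0" and lap: "gen_laplacian n L"
    and Dij: "\<And>i j. i < n \<Longrightarrow> j < n \<Longrightarrow> D $$ (i,j) =
          a\<^sup>2 * L $$ (i,i) + b\<^sup>2 * L $$ (j,j) - 2 * a * b * L $$ (i,j)"
    using assms(1) unfolding gen_euclidean_dist_def by blast
  have L: "L \<in> carrier_mat n n" and psd: "pos_semidef L" and L1: "L *\<^sub>v ones_vec n = 0\<^sub>v n"
    using lap unfolding gen_laplacian_def by auto
  have symL: "L $$ (i,j) = L $$ (j,i)" if "i < n" "j < n" for i j
    using psd symmetric_matrixD[OF _ L that] unfolding pos_semidef_def by blast
  have n: "real n > 0"
  proof (rule ccontr)
    assume "\<not> real n > 0"
    hence "D = 0\<^sub>m n n" using D by (intro eq_matI) auto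
    thus False using assms(2) by simp
  qed
  have row: "(\<Sum>k<n. L $$ (i,k)) = 0" if "i < n" for i
    using arg_cong[OF L1, of "\<lambda>v. v $ i"] L that
    by (simp add: ones_vec_def scalar_prod_def atLeast0LessThan)
  define m where "m = (\<Sum>k<n. L $$ (k,k)) / n"
  have sum_diag: "(\<Sum>k<n. L $$ (k,k)) = n * m" using n by (simp add: m_def)
  have m: "m \<ge> 0" unfolding m_def using pos_semidef_diag_nonneg[OF psd L]
    by (intro divide_nonneg_nonneg sum_nonneg) auto
  \<comment> \<open>The constant term makes the entries of \<open>S\<close> and \<open>D\<close>
    have the same total, \<open>n\<^sup>2 * m * (a\<^sup>2 + b\<^sup>2)\<close>; the similarity
    preserves this all-ones block.\<close>
  define S where "S = mat n n (\<lambda>(i,j). a * b * (L $$ (i,i) + L $$ (j,j) - 2 * L $$ (i,j)) + m * (a - b)\<^sup>2)"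
  have S: "S \<in> carrier_mat n n" by (simp add: S_def)
  have Sij: "S $$ (i,j) = a * b * (L $$ (i,i) + L $$ (j,j) - 2 * L $$ (i,j)) + m * (a - b)\<^sup>2"
    if "i < n" "j < n" for i j
    using that by (simp add: S_def)
  have symS: "symmetric_matrix S"
    unfolding symmetric_matrix_def
    by (auto simp: S_def symL intro!: eq_matI)
  have Srow: "(\<Sum>k<n. S $$ (i,k)) = n * (a * b * (L $$ (i,i) + m) + m * (a - b)\<^sup>2)" if "i < n" for i
  proof -
    have "(\<Sum>k<n. S $$ (i,k)) = a * b * (n * L $$ (i,i) + (\<Sum>k<n. L $$ (k,k)) - 2 * (\<Sum>k<n. L $$ (i,k)))
        + n * (m * (a - b)\<^sup>2)"
      using that by (simp add: Sij sum.distrib sum_subtractf flip: sum_distrib_left)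
    thus ?thesis using that by (simp add: row sum_diag algebra_simps)
  qed
  have Scol: "(\<Sum>k<n. S $$ (k,j)) = n * (a * b * (L $$ (j,j) + m) + m * (a - b)\<^sup>2)" if "j < n" for j
    using Srow[OF that] symmetric_matrixD[OF symS S that] by simp
  \<comment> \<open>\<open>?P\<close> scales the all-ones direction by \<open>1 + c = b / a\<close>,
    and \<open>?Q\<close> by the inverse ratio \<open>1 + d = a / b\<close>.\<close>
  define c where "c = b / a - 1"
  define d where "d = a / b - 1"
  have cd: "c + d + c * d = 0" unfolding c_def d_def using ab by (simp add: field_simps)
  let ?P = "ones_scaling n c" and ?Q = "ones_scaling n d"
  have "D = ?P * S * ?Q"
  proof (intro eq_matI)
    fix i j assume "i < dim_row (?P * S * ?Q)" "j < dim_col (?P * S * ?Q)"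
    hence ij: "i < n" "j < n" by (auto simp: ones_scaling_def)
    have PS: "(?P * S) $$ (i,k) = S $$ (i,k) + c * (a * b * (L $$ (k,k) + m) + m * (a - b)\<^sup>2)" if "k < n" for k
      using n ij that by (simp add: ones_scaling_mult_index(1)[OF S] Scol del: index_mult_mat)
    have "(\<Sum>k<n. (?P * S) $$ (i,k)) = (\<Sum>k<n. S $$ (i,k)) +
        c * (a * b * ((\<Sum>k<n. L $$ (k,k)) + n * m) + n * (m * (a - b)\<^sup>2))"
      by (simp add: PS sum.distrib del: index_mult_mat flip: sum_distrib_left)
    also have "\<dots> = n * (a * b * (L $$ (i,i) + m) + m * (a - b)\<^sup>2 + c * (2 * a * b * m + m * (a - b)\<^sup>2))"
      by (simp add: Srow[OF ij(1)] sum_diag algebra_simps)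
    finally have "(?P * S * ?Q) $$ (i,j) = S $$ (i,j) + c * (a * b * (L $$ (j,j) + m) + m * (a - b)\<^sup>2)
        + d * (a * b * (L $$ (i,i) + m) + m * (a - b)\<^sup>2 + c * (2 * a * b * m + m * (a - b)\<^sup>2))"
      using n ij S PS[OF ij(2)]
      by (subst ones_scaling_mult_index(2)[OF mult_carrier_mat[OF ones_scaling_carrier S]])
        (auto simp del: index_mult_mat)
    also have "\<dots> = D $$ (i,j)"
      unfolding Dij[OF ij] Sij[OF ij] c_def d_def using ab
      by (simp add: field_simps power2_eq_square)
    finally show "D $$ (i,j) = (?P * S * ?Q) $$ (i,j)" ..
  qed (use D in \<open>auto simp: ones_scaling_def\<close>)
  hence wit: "similar_mat_wit D S ?P ?Q"
    using cd D S by (intro similar_mat_witI[of _ _ n] ones_scaling_mult) (auto simp: algebra_simps)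
  hence sim: "similar_mat D S" unfolding similar_mat_def by blast
  have "num_pos_eigenvalues S = 1"
  proof (rule num_pos_eigenvalues_eq_1[OF S symS])
    show "ones_vec n \<in> carrier_vec n" by (simp add: ones_vec_def)
  next
    fix x :: "real vec" assume x: "x \<in> carrier_vec n" and "ones_vec n \<bullet> x = 0"
    hence x0: "(\<Sum>j<n. x $ j) = 0" by (simp add: ones_vec_def scalar_prod_def atLeast0LessThan)
    have quad: "x \<bullet> (A *\<^sub>v x) = (\<Sum>i<n. \<Sum>j<n. x $ i * x $ j * A $$ (i,j))" if "A \<in> carrier_mat n n" for A
      using x that by (simp add: scalar_prod_def atLeast0LessThan sum_distrib_left mult_ac)
    \<comment> \<open>The terms are grouped so that each one not involving \<open>L $$ (i,j)\<close>
      has a bare factor \<open>x $ i\<close> or \<open>x $ j\<close>, whose sum is zero.\<close>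
    have "x \<bullet> (S *\<^sub>v x) = (\<Sum>i<n. \<Sum>j<n. (a * b * (x $ i * L $$ (i,i)) + m * (a - b)\<^sup>2 * x $ i) * x $ j
        + a * b * x $ i * (x $ j * L $$ (j,j)) - 2 * a * b * (x $ i * x $ j * L $$ (i,j)))"
      unfolding quad[OF S] by (intro sum.cong) (auto simp: Sij algebra_simps)
    also have "\<dots> = (\<Sum>i<n. a * b * x $ i * (\<Sum>j<n. x $ j * L $$ (j,j))) - 2 * a * b * (x \<bullet> (L *\<^sub>v x))"
      unfolding quad[OF L] by (simp add: sum.distrib sum_subtractf x0 flip: sum_distrib_left)
    also have "(\<Sum>i<n. a * b * x $ i * (\<Sum>j<n. x $ j * L $$ (j,j))) = 0"
      by (simp add: x0 flip: sum_distrib_left sum_distrib_right)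
    finally have "x \<bullet> (S *\<^sub>v x) = - (2 * a * b * (x \<bullet> (L *\<^sub>v x)))" by simp
    moreover have "x \<bullet> (L *\<^sub>v x) \<ge> 0" using psd L x unfolding pos_semidef_def by auto
    ultimately show "x \<bullet> (S *\<^sub>v x) \<le> 0" using ab by simp
  next
    \<comment> \<open>On the diagonal the bracket in \<open>S\<close> cancels, leaving
      \<open>m * (a - b)\<^sup>2\<close>.\<close>
    show "(\<Sum>i<n. S $$ (i,i)) \<ge> 0" using m by (intro sum_nonneg) (simp add: Sij)
  next
    show "S \<noteq> 0\<^sub>m n n"
    proof
      assume "S = 0\<^sub>m n n"
      hence "D = 0\<^sub>m n n" using similar_mat_witD2(3,6,7)[OF D wit]
        by (metis left_mult_zero_mat right_mult_zero_mat)
      thus False using assms(2) by simp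
    qed
  qed
  thus ?thesis using S symS sim num_pos_eigenvalues_similar[OF D sim] by auto
qed

end
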